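(* Let $(M^4,g(t))_{t\in[0,T)}$ be a solution to Ricci flow satisfying the basic assumptions, and let $R,v,\varepsilon_0$ be the fixed constants described in the context. Then: (1) $\mathrm{Reg}_t(M)\subseteq\mathrm{Reg}(M)$ for all good times $t\in(T-v,T)$. (2) For every $p\in\mathrm{Reg}(M)$ there exists $S(p)$ with $T-v<S(p)<T$ such that $p\in\mathrm{Reg}_t(M)$ for all good times $t\in(S(p),T)$. (3) For every good time $t\in(T-v,T)$ and every $\varepsilon>0$ there exists $\delta>0$ (depending on $t$) such that $$(1-\varepsilon)\,g(p,s)\le g(p,r)\le(1+\varepsilon)\,g(p,s)$$ for all $p\in\mathrm{Reg}_t(M)$ and all $r,s\in(t,T)$ with $|r-s|\le\delta$.
   Context: Basic assumptions: $M^4$ is a smooth, compact, connected four-dimensional manifold without boundary; $(M^4,g(t))_{t\in[0,T)}$ is a smooth solution of the Ricci flow $\partial_t g=-2\,\mathrm{Ricci}(g)$; $T<\infty$; and the scalar curvature satisfies $\sup_{M\times[0,T)}|\mathrm R|\le1$. Notation: ${}^tB_r(p)$ is the open ball of radius $r$ about $p$ with respect to the distance of $g(t)$; $g(p,t)$ is the metric $g(t)$ at $p$. Good time: $t\in[0,T)$ is a good time if $\int_M|\mathrm{Rc}|^4(\cdot,t)\,d\mu_{g(t)}\le\frac1{T-t}$. Regular points: $\mathrm{Reg}(M)$ is the set of $p\in M$ for which there is $r=r(p)>0$ with $\int_{{}^tB_r(p)}|\mathrm{Riem}|^2(\cdot,t)\,d\mu_{g(t)}\le\varepsilon_0$ for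 all $t\in[0,T)$. For $t\in(0,T)$, $\mathrm{Reg}_t(M)$ is the set of $p\in M$ with $\int_{{}^tB_{R\sqrt{T-t}}(p)}|\mathrm{Riem}|^2(\cdot,t)\,d\mu_{g(t)}\le\varepsilon_0$. Fixed constants: $R>0$ (large) and $v,\varepsilon_0>0$ (small), depending only on $(M,g(0))$ and $T$, are fixed with the following property (such constants exist by an earlier theorem of the paper): whenever $t$ is a good time with $|T-t|\le v$ and $p\in\mathrm{Reg}_t(M)$, then $p$ and all points of ${}^tB_{\frac R2\sqrt{T-t}}(p)$ lie in $\mathrm{Reg}(M)$, and on ${}^tB_{\frac R2\sqrt{T-t}}(p)$ one has, for all $r,s\in[t,T)$, $\frac12g(r)\le g(s)\le2g(r)$ and $e^{-\theta}g(r)\le g(s)\le e^{\theta}g(r)$ with $\theta=8|(r-t)^{1/4}-(s-t)^{1/4}|/(T-t)^{1/4}$. *)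

theory Defs
  imports "HOL-Analysis.Analysis"
begin

section \<open>Smooth functions on subsets of Euclidean spaces\<close>

text \<open>
  Derivatives are taken within \<open>S\<close>, so that the notion makes sense on open sets and also on sets
  such as \<open>V \<times> [0,T)\<close> (one-sided time derivatives at \<open>0\<close>) and \<open>[a,b]\<close>. On all of these the
  derivative within \<open>S\<close> is unique, and \<open>D b\<close> is the partial derivative in the direction \<open>b\<close>.
\<close>

fun Ck_on :: "nat \<Rightarrow> ('e::euclidean_space \<Rightarrow> real) \<Rightarrow> 'e set \<Rightarrow> bool" where
  "Ck_on 0 f S \<longleftrightarrow> continuous_on S f"
| "Ck_on (Suc k) f S \<longleftrightarrow>
     (\<exists>D. (\<forall>x\<in>S. (f has_derivative (\<lambda>h. \<Sum>b\<in>Basis. (h \<bullet> b) * D b x)) (at x within S)) \<and>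
          (\<forall>b\<in>Basis. Ck_on k (D b) S))"

definition smooth_on :: "('e::euclidean_space \<Rightarrow> real) \<Rightarrow> 'e set \<Rightarrow> bool" where
  "smooth_on f S \<longleftrightarrow> (\<forall>k. Ck_on k f S)"

definition partial :: "'n::finite \<Rightarrow> (real^'n \<Rightarrow> real) \<Rightarrow> real^'n \<Rightarrow> real" where
  "partial k F x = deriv (\<lambda>s. F (x + s *\<^sub>R axis k 1)) 0"


section \<open>Smooth manifolds\<close>

text \<open>
  The manifold is the whole of a topological space type. Since charts map onto open subsets of
  \<open>real^'n\<close>, there is no boundary. A chart is a pair of its domain and its coordinate map; the
  values of the coordinate map outside the domain are irrelevant.
\<close>

type_synonym ('a, 'n) chart = "'a set \<times> ('a \<Rightarrow> real^'n)"

definition is_chart :: "('a::topological_space, 'n::finite) chart \<Rightarrow> bool" where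
  "is_chart c \<longleftrightarrow>
     open (fst c) \<and> open (snd c ` fst c) \<and> (\<exists>\<psi>. homeomorphism (fst c) (snd c ` fst c) (snd c) \<psi>)"

definition chart_inv :: "('a, 'n::finite) chart \<Rightarrow> real^'n \<Rightarrow> 'a" where
  "chart_inv c = inv_into (fst c) (snd c)"

definition smooth_atlas :: "('a::topological_space, 'n::finite) chart set \<Rightarrow> bool" where
  "smooth_atlas A \<longleftrightarrow>
     (\<forall>c\<in>A. is_chart c) \<and> (\<Union>c\<in>A. fst c) = UNIV \<and>
     (\<forall>c\<in>A. \<forall>d\<in>A. \<forall>i. smooth_on (\<lambda>x. snd d (chart_inv c x) $ i) (snd c ` (fst c \<inter> fst d)))"

definition chart_at :: "('a, 'n::finite) chart set \<Rightarrow> 'a \<Rightarrow> ('a, 'n) chart" where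
  "chart_at A p = (SOME c. c \<in> A \<and> p \<in> fst c)"

definition smooth_fun :: "('a, 'n::finite) chart set \<Rightarrow> ('a \<Rightarrow> real) \<Rightarrow> bool" where
  "smooth_fun A f \<longleftrightarrow> (\<forall>c\<in>A. smooth_on (f \<circ> chart_inv c) (snd c ` fst c))"


section \<open>Tangent vectors\<close>

text \<open>
  Tangent vectors at \<open>p\<close> are the derivations at \<open>p\<close> of the algebra of smooth functions. As HOL
  functions are total, a derivation is extended by \<open>0\<close> to functions that are not smooth; this
  makes its representation unique.
\<close>

type_synonym 'a tvec = "('a \<Rightarrow> real) \<Rightarrow> real"

definition tangent_space :: "('a, 'n::finite) chart set \<Rightarrow> 'a \<Rightarrow> 'a tvec set" where
  "tangent_space A p = {X.
     (\<forall>f. \<not> smooth_fun A f \<longrightarrow> X f = 0) \<and>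
     (\<forall>f h a b. smooth_fun A f \<longrightarrow> smooth_fun A h \<longrightarrow>
        X (\<lambda>x. a * f x + b * h x) = a * X f + b * X h) \<and>
     (\<forall>f h. smooth_fun A f \<longrightarrow> smooth_fun A h \<longrightarrow>
        X (\<lambda>x. f x * h x) = f p * X h + h p * X f)}"

definition coord_vec :: "('a, 'n::finite) chart set \<Rightarrow> ('a, 'n) chart \<Rightarrow> 'a \<Rightarrow> 'n \<Rightarrow> 'a tvec" where
  "coord_vec A c p i =
     (\<lambda>f. if smooth_fun A f then partial i (f \<circ> chart_inv c) (snd c p) else 0)"

definition velocity :: "('a, 'n::finite) chart set \<Rightarrow> (real \<Rightarrow> 'a) \<Rightarrow> real \<Rightarrow> 'a tvec" where
  "velocity A \<gamma> s = (\<lambda>f. if smooth_fun A f then deriv (f \<circ> \<gamma>) s else 0)"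


section \<open>Riemannian metrics, distance and volume\<close>

type_synonym 'a metric = "'a \<Rightarrow> 'a tvec \<Rightarrow> 'a tvec \<Rightarrow> real"

definition metric_coeff ::
    "('a, 'n::finite) chart set \<Rightarrow> 'a metric \<Rightarrow> ('a, 'n) chart \<Rightarrow> real^'n \<Rightarrow> real^'n^'n" where
  "metric_coeff A h c x =
     (\<chi> i j. h (chart_inv c x) (coord_vec A c (chart_inv c x) i) (coord_vec A c (chart_inv c x) j))"

definition riemannian_metric :: "('a, 'n::finite) chart set \<Rightarrow> 'a metric \<Rightarrow> bool" where
  "riemannian_metric A h \<longleftrightarrow>
     (\<forall>p. (\<forall>X\<in>tangent_space A p. \<forall>Y\<in>tangent_space A p. \<forall>Z\<in>tangent_space A p. \<forall>a b.
             h p (\<lambda>f. a * X f + b * Y f) Z = a * h p X Z + b * h p Y Z) \<and>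
          (\<forall>X\<in>tangent_space A p. \<forall>Y\<in>tangent_space A p. h p X Y = h p Y X) \<and>
          (\<forall>X\<in>tangent_space A p. X \<noteq> (\<lambda>f. 0) \<longrightarrow> 0 < h p X X)) \<and>
     (\<forall>c\<in>A. \<forall>i j. smooth_on (\<lambda>x. metric_coeff A h c x $ i $ j) (snd c ` fst c))"

text \<open>The order on symmetric bilinear forms at \<open>p\<close> given by the associated quadratic forms.\<close>

definition form_le ::
    "('a, 'n::finite) chart set \<Rightarrow> 'a \<Rightarrow> ('a tvec \<Rightarrow> 'a tvec \<Rightarrow> real) \<Rightarrow> ('a tvec \<Rightarrow> 'a tvec \<Rightarrow> real) \<Rightarrow> bool"
  where "form_le A p B B' \<longleftrightarrow> (\<forall>X\<in>tangent_space A p. B X X \<le> B' X X)"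

abbreviation form_scale :: "real \<Rightarrow> ('a tvec \<Rightarrow> 'a tvec \<Rightarrow> real) \<Rightarrow> 'a tvec \<Rightarrow> 'a tvec \<Rightarrow> real" where
  "form_scale k B \<equiv> (\<lambda>X Y. k * B X Y)"

text \<open>Continuous curves on \<open>[0,1]\<close> that are smooth on each closed piece of a finite subdivision.\<close>

definition piecewise_smooth_curve ::
    "('a::topological_space, 'n::finite) chart set \<Rightarrow> (real \<Rightarrow> 'a) \<Rightarrow> bool" where
  "piecewise_smooth_curve A \<gamma> \<longleftrightarrow>
     path \<gamma> \<and>
     (\<exists>P. finite P \<and> {0, 1} \<subseteq> P \<and> P \<subseteq> {0..1} \<and>
          (\<forall>a\<in>P. \<forall>b\<in>P. a < b \<longrightarrow> {a<..<b} \<inter> P = {} \<longrightarrow>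
             (\<forall>f. smooth_fun A f \<longrightarrow> smooth_on (f \<circ> \<gamma>) {a..b})))"

definition curve_length ::
    "('a, 'n::finite) chart set \<Rightarrow> 'a metric \<Rightarrow> (real \<Rightarrow> 'a) \<Rightarrow> ennreal" where
  "curve_length A h \<gamma> =
     (\<integral>\<^sup>+s\<in>{0..1}. ennreal (sqrt (h (\<gamma> s) (velocity A \<gamma> s) (velocity A \<gamma> s))) \<partial>lborel)"

definition riem_dist ::
    "('a::topological_space, 'n::finite) chart set \<Rightarrow> 'a metric \<Rightarrow> 'a \<Rightarrow> 'a \<Rightarrow> ennreal" where
  "riem_dist A h p q =
     (INF \<gamma>\<in>{\<gamma>. piecewise_smooth_curve A \<gamma> \<and> \<gamma> 0 = p \<and> \<gamma> 1 = q}. curve_length A h \<gamma>)"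

definition riem_ball ::
    "('a::topological_space, 'n::finite) chart set \<Rightarrow> 'a metric \<Rightarrow> 'a \<Rightarrow> real \<Rightarrow> 'a set" where
  "riem_ball A h p r = {q. riem_dist A h p q < ennreal r}"

text \<open>
  The Riemannian measure is the unique Borel measure that in each chart has density
  \<open>sqrt (det g\<^sub>i\<^sub>j)\<close> with respect to Lebesgue measure.
\<close>

definition riem_measure ::
    "('a::topological_space, 'n::finite) chart set \<Rightarrow> 'a metric \<Rightarrow> 'a measure" where
  "riem_measure A h = (THE \<mu>. sets \<mu> = sets borel \<and>
     (\<forall>c\<in>A. \<forall>E\<in>sets borel. E \<subseteq> fst c \<longrightarrow>
        emeasure \<mu> E = (\<integral>\<^sup>+x\<in>snd c ` E. ennreal (sqrt (det (metric_coeff A h c x))) \<partial>lborel)))"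


section \<open>Curvature\<close>

text \<open>
  Component formulas in a chart, at the coordinate point \<open>x\<close>. In \<open>riem_coeff\<close> the index order is
  \<open>R(\<partial>\<^sub>i, \<partial>\<^sub>j) \<partial>\<^sub>k = \<Sum>\<^sub>l (riem_coeff A h c x l i j k) \<partial>\<^sub>l\<close> with
  \<open>R(X, Y) = [\<nabla>\<^sub>X, \<nabla>\<^sub>Y] - \<nabla>\<^bsub>[X, Y]\<^esub>\<close>, and \<open>Ric(Y, Z)\<close> is the trace of \<open>X \<mapsto> R(X, Y) Z\<close>,
  so that round spheres have positive Ricci curvature.
\<close>

definition metric_inv ::
    "('a, 'n::finite) chart set \<Rightarrow> 'a metric \<Rightarrow> ('a, 'n) chart \<Rightarrow> real^'n \<Rightarrow> real^'n^'n" where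
  "metric_inv A h c x = matrix_inv (metric_coeff A h c x)"

definition christoffel ::
    "('a, 'n::finite) chart set \<Rightarrow> 'a metric \<Rightarrow> ('a, 'n) chart \<Rightarrow> real^'n \<Rightarrow> 'n \<Rightarrow> 'n \<Rightarrow> 'n \<Rightarrow> real" where
  "christoffel A h c x k i j =
     (\<Sum>l\<in>UNIV. metric_inv A h c x $ k $ l *
        (partial i (\<lambda>y. metric_coeff A h c y $ j $ l) x
         + partial j (\<lambda>y. metric_coeff A h c y $ i $ l) x
         - partial l (\<lambda>y. metric_coeff A h c y $ i $ j) x)) / 2"

definition riem_coeff ::
    "('a, 'n::finite) chart set \<Rightarrow> 'a metric \<Rightarrow> ('a, 'n) chart \<Rightarrow> real^'n
       \<Rightarrow> 'n \<Rightarrow> 'n \<Rightarrow> 'n \<Rightarrow> 'n \<Rightarrow> real" where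
  "riem_coeff A h c x l i j k =
     partial i (\<lambda>y. christoffel A h c y l j k) x
     - partial j (\<lambda>y. christoffel A h c y l i k) x
     + (\<Sum>m\<in>UNIV. christoffel A h c x l i m * christoffel A h c x m j k
                 - christoffel A h c x l j m * christoffel A h c x m i k)"

definition ric_coeff ::
    "('a, 'n::finite) chart set \<Rightarrow> 'a metric \<Rightarrow> ('a, 'n) chart \<Rightarrow> real^'n \<Rightarrow> 'n \<Rightarrow> 'n \<Rightarrow> real" where
  "ric_coeff A h c x j k = (\<Sum>i\<in>UNIV. riem_coeff A h c x i i j k)"

definition scal_coord ::
    "('a, 'n::finite) chart set \<Rightarrow> 'a metric \<Rightarrow> ('a, 'n) chart \<Rightarrow> real^'n \<Rightarrow> real" where
  "scal_coord A h c x = (\<Sum>j\<in>UNIV. \<Sum>k\<in>UNIV. metric_inv A h c x $ j $ k * ric_coeff A h c x j k)"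

definition ric_norm_sq_coord ::
    "('a, 'n::finite) chart set \<Rightarrow> 'a metric \<Rightarrow> ('a, 'n) chart \<Rightarrow> real^'n \<Rightarrow> real" where
  "ric_norm_sq_coord A h c x =
     (\<Sum>i\<in>UNIV. \<Sum>j\<in>UNIV. \<Sum>a\<in>UNIV. \<Sum>b\<in>UNIV.
        metric_inv A h c x $ i $ a * metric_inv A h c x $ j $ b *
        ric_coeff A h c x i j * ric_coeff A h c x a b)"

definition riem_norm_sq_coord ::
    "('a, 'n::finite) chart set \<Rightarrow> 'a metric \<Rightarrow> ('a, 'n) chart \<Rightarrow> real^'n \<Rightarrow> real" where
  "riem_norm_sq_coord A h c x =
     (\<Sum>l\<in>UNIV. \<Sum>i\<in>UNIV. \<Sum>j\<in>UNIV. \<Sum>k\<in>UNIV. \<Sum>p\<in>UNIV. \<Sum>a\<in>UNIV. \<Sum>b\<in>UNIV. \<Sum>d\<in>UNIV.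
        metric_coeff A h c x $ l $ p * metric_inv A h c x $ i $ a *
        metric_inv A h c x $ j $ b * metric_inv A h c x $ k $ d *
        riem_coeff A h c x l i j k * riem_coeff A h c x p a b d)"

text \<open>The scalar quantities do not depend on the chart, so any chart around \<open>p\<close> may be used.\<close>

definition scal :: "('a, 'n::finite) chart set \<Rightarrow> 'a metric \<Rightarrow> 'a \<Rightarrow> real" where
  "scal A h p = scal_coord A h (chart_at A p) (snd (chart_at A p) p)"

definition ric_norm :: "('a, 'n::finite) chart set \<Rightarrow> 'a metric \<Rightarrow> 'a \<Rightarrow> real" where
  "ric_norm A h p = sqrt (ric_norm_sq_coord A h (chart_at A p) (snd (chart_at A p) p))"

definition riem_norm :: "('a, 'n::finite) chart set \<Rightarrow> 'a metric \<Rightarrow> 'a \<Rightarrow> real" where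
  "riem_norm A h p = sqrt (riem_norm_sq_coord A h (chart_at A p) (snd (chart_at A p) p))"


section \<open>Ricci flow\<close>

definition ricci_flow ::
    "('a, 'n::finite) chart set \<Rightarrow> (real \<Rightarrow> 'a metric) \<Rightarrow> real \<Rightarrow> bool" where
  "ricci_flow A g T \<longleftrightarrow>
     0 < T \<and>
     (\<forall>t\<in>{0..<T}. riemannian_metric A (g t)) \<and>
     (\<forall>c\<in>A. \<forall>i j. smooth_on (\<lambda>(x, t). metric_coeff A (g t) c x $ i $ j)
                            ((snd c ` fst c) \<times> {0..<T})) \<and>
     (\<forall>c\<in>A. \<forall>x\<in>snd c ` fst c. \<forall>t\<in>{0..<T}. \<forall>i j.
        ((\<lambda>s. metric_coeff A (g s) c x $ i $ j) has_real_derivative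
           - 2 * ric_coeff A (g t) c x i j) (at t within {0..<T}))"

definition basic_assumptions ::
    "('a::t2_space, 'n::finite) chart set \<Rightarrow> (real \<Rightarrow> 'a metric) \<Rightarrow> real \<Rightarrow> bool" where
  "basic_assumptions A g T \<longleftrightarrow>
     smooth_atlas A \<and> compact (UNIV :: 'a set) \<and> connected (UNIV :: 'a set) \<and>
     ricci_flow A g T \<and>
     (\<forall>p. \<forall>t\<in>{0..<T}. \<bar>scal A (g t) p\<bar> \<le> 1)"

definition good_time ::
    "('a::topological_space, 'n::finite) chart set \<Rightarrow> (real \<Rightarrow> 'a metric) \<Rightarrow> real \<Rightarrow> real \<Rightarrow> bool" where
  "good_time A g T t \<longleftrightarrow>
     t \<in> {0..<T} \<and>
     (\<integral>\<^sup>+x. ennreal (ric_norm A (g t) x ^ 4) \<partial>riem_measure A (g t)) \<le> ennreal (1 / (T - t))"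

definition curv_energy ::
    "('a::topological_space, 'n::finite) chart set \<Rightarrow> 'a metric \<Rightarrow> 'a set \<Rightarrow> ennreal" where
  "curv_energy A h B = (\<integral>\<^sup>+x\<in>B. ennreal ((riem_norm A h x)\<^sup>2) \<partial>riem_measure A h)"

definition Reg ::
    "('a::topological_space, 'n::finite) chart set \<Rightarrow> (real \<Rightarrow> 'a metric) \<Rightarrow> real \<Rightarrow> real \<Rightarrow> 'a set" where
  "Reg A g T \<epsilon>\<^sub>0 =
     {p. \<exists>r>0. \<forall>t\<in>{0..<T}. curv_energy A (g t) (riem_ball A (g t) p r) \<le> ennreal \<epsilon>\<^sub>0}"

text \<open>Only defined for \<open>t \<in> (0,T)\<close>; by convention it is empty for other \<open>t\<close>.\<close>

definition Reg_at ::
    "('a::topological_space, 'n::finite) chart set \<Rightarrow> (real \<Rightarrow> 'a metric) \<Rightarrow> real \<Rightarrow> real \<Rightarrow> real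
       \<Rightarrow> real \<Rightarrow> 'a set" where
  "Reg_at A g T R \<epsilon>\<^sub>0 t =
     {p. t \<in> {0<..<T} \<and>
         curv_energy A (g t) (riem_ball A (g t) p (R * sqrt (T - t))) \<le> ennreal \<epsilon>\<^sub>0}"

definition regularity_constants ::
    "('a::topological_space, 'n::finite) chart set \<Rightarrow> (real \<Rightarrow> 'a metric) \<Rightarrow> real
       \<Rightarrow> real \<Rightarrow> real \<Rightarrow> real \<Rightarrow> bool" where
  "regularity_constants A g T R v \<epsilon>\<^sub>0 \<longleftrightarrow>
     0 < R \<and> 0 < v \<and> 0 < \<epsilon>\<^sub>0 \<and>
     (\<forall>t p. good_time A g T t \<longrightarrow> \<bar>T - t\<bar> \<le> v \<longrightarrow> p \<in> Reg_at A g T R \<epsilon>\<^sub>0 t \<longrightarrow>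
        p \<in> Reg A g T \<epsilon>\<^sub>0 \<and>
        riem_ball A (g t) p (R / 2 * sqrt (T - t)) \<subseteq> Reg A g T \<epsilon>\<^sub>0 \<and>
        (\<forall>q\<in>riem_ball A (g t) p (R / 2 * sqrt (T - t)). \<forall>r\<in>{t..<T}. \<forall>s\<in>{t..<T}.
           form_le A q (form_scale (1 / 2) (g r q)) (g s q) \<and>
           form_le A q (g s q) (form_scale 2 (g r q)) \<and>
           (let \<theta> = 8 * \<bar>(r - t) powr (1 / 4) - (s - t) powr (1 / 4)\<bar> / (T - t) powr (1 / 4)
            in form_le A q (form_scale (exp (- \<theta>)) (g r q)) (g s q) \<and>
               form_le A q (g s q) (form_scale (exp \<theta>) (g r q)))))"

end

theory Submission
  imports Defs
begin

lemma Ck_on_const: "Ck_on k (\<lambda>x. c) S"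
\<comment> \<open>The constant must vary: the partial derivatives are the constant 0, and the
  induction hypothesis is applied to them.\<close>
proof (induction k arbitrary: c)
  case (Suc k)
  have "((\<lambda>x. c) has_derivative (\<lambda>h. \<Sum>b\<in>Basis. (h \<bullet> b) * 0)) (at x within S)" for x
    by simp
  with Suc show ?case
    by (auto intro!: exI[of _ "\<lambda>b x. 0"])
qed simp

lemma smooth_on_const: "smooth_on (\<lambda>x. c) S"
  by (simp add: smooth_on_def Ck_on_const)

text \<open>The trivial subdivision suffices. This curve is the competitor that gives each point
  distance 0 from itself.\<close>

lemma piecewise_smooth_curve_const: "piecewise_smooth_curve A (\<lambda>s. p)"
  unfolding piecewise_smooth_curve_def
  by (auto simp: path_def comp_def smooth_on_const intro!: exI[of _ "{0, 1}"])

lemma velocity_const: "velocity A (\<lambda>s. p) s = (\<lambda>f. 0)"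
  by (auto simp: velocity_def comp_def)

lemma zero_in_tangent_space: "(\<lambda>f. 0) \<in> tangent_space A p"
  by (simp add: tangent_space_def)

text \<open>Linearity in the first argument with both coefficients 0.\<close>

lemma riemannian_metric_zero:
  assumes "riemannian_metric A h"
  shows "h p (\<lambda>f. 0) (\<lambda>f. 0) = 0"
proof -
  let ?Z = "(\<lambda>f. 0) :: 'a tvec"
  have "\<forall>X\<in>tangent_space A p. \<forall>Y\<in>tangent_space A p. \<forall>Z\<in>tangent_space A p. \<forall>a b.
          h p (\<lambda>f. a * X f + b * Y f) Z = a * h p X Z + b * h p Y Z"
    using assms[unfolded riemannian_metric_def, THEN conjunct1, THEN spec, THEN conjunct1] .
  from this[rule_format, of ?Z ?Z ?Z 0 0] show ?thesis
    by (simp add: zero_in_tangent_space)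
qed

lemma riemannian_metric_nonneg:
  assumes "riemannian_metric A h" and "X \<in> tangent_space A p"
  shows "0 \<le> h p X X"
proof (cases "X = (\<lambda>f. 0)")
  case True
  then show ?thesis using riemannian_metric_zero[OF assms(1)] by simp
next
  case False
  then have "0 < h p X X"
    using assms(1)[unfolded riemannian_metric_def, THEN conjunct1, THEN spec, THEN conjunct2,
        THEN conjunct2] assms(2) by blast
  then show ?thesis by simp
qed

text \<open>The constant curve has zero velocity, hence zero length.\<close>

lemma riem_dist_refl:
  assumes "riemannian_metric A h"
  shows "riem_dist A h p p = 0"
proof -
  have "curve_length A h (\<lambda>s. p) = 0"
    by (simp add: curve_length_def velocity_const riemannian_metric_zero[OF assms])
  moreover have "riem_dist A h p p \<le> curve_length A h (\<lambda>s. p)"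
    unfolding riem_dist_def by (rule INF_lower) (simp add: piecewise_smooth_curve_const)
  ultimately show ?thesis by simp
qed

lemma centre_in_riem_ball:
  assumes "riemannian_metric A h" and "0 < r"
  shows "p \<in> riem_ball A h p r"
  using assms by (simp add: riem_ball_def riem_dist_refl)

lemma riem_ball_mono: "r \<le> r' \<Longrightarrow> riem_ball A h p r \<subseteq> riem_ball A h p r'"
  unfolding riem_ball_def by (auto intro: less_le_trans ennreal_leI)

lemma curv_energy_mono: "B \<subseteq> B' \<Longrightarrow> curv_energy A h B \<le> curv_energy A h B'"
  unfolding curv_energy_def by (intro nn_integral_mono) (auto split: split_indicator)

text \<open>Once \<open>R * sqrt (T - t)\<close> is at most the radius r that witnesses regularity,
  the shrinking ball lies inside the fixed one and inherits its energy bound.\<close>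

lemma Reg_imp_eventually_Reg_at:
  assumes "p \<in> Reg A g T \<epsilon>\<^sub>0" and "0 < R" and "U < T" and "0 < T"
  obtains S where "U < S" "S < T" "\<And>t. t \<in> {S<..<T} \<Longrightarrow> p \<in> Reg_at A g T R \<epsilon>\<^sub>0 t"
proof -
  obtain r where r: "0 < r"
    and energy: "\<And>t. t \<in> {0..<T} \<Longrightarrow> curv_energy A (g t) (riem_ball A (g t) p r) \<le> ennreal \<epsilon>\<^sub>0"
    using assms(1) unfolding Reg_def by blast
  \<comment> \<open>The term 0 keeps t positive, as \<open>Reg_at\<close> is empty otherwise; the
    midpoint lies strictly between U and T; the last term is where \<open>R * sqrt (T - t)\<close>
    equals r.\<close>
  define S where "S = max (max 0 ((U + T) / 2)) (T - (r / R)\<^sup>2)"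
  show thesis
  proof
    show "U < S" "S < T"
      using assms r by (auto simp: S_def less_max_iff_disj)
    fix t assume t: "t \<in> {S<..<T}"
    then have "T - t \<le> (r / R)\<^sup>2" "0 < t" "t < T"
      by (auto simp: S_def)
    then have "sqrt (T - t) \<le> r / R"
      using r assms(2) by (intro real_le_lsqrt) auto
    then have "R * sqrt (T - t) \<le> r"
      using assms(2) by (simp add: field_simps)
    then have "curv_energy A (g t) (riem_ball A (g t) p (R * sqrt (T - t))) \<le> ennreal \<epsilon>\<^sub>0"
      using order_trans[OF curv_energy_mono[OF riem_ball_mono] energy[of t]] \<open>0 < t\<close> \<open>t < T\<close>
      by simp
    with \<open>0 < t\<close> \<open>t < T\<close> show "p \<in> Reg_at A g T R \<epsilon>\<^sub>0 t"
      by (simp add: Reg_at_def)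
  qed
qed

text \<open>Heine-Cantor on a compact interval. A positive exponent makes the power continuous up to
  0, where for q < 1 its slope is unbounded.\<close>

lemma powr_uniformly_close:
  fixes b q e :: real
  assumes "0 < q" and "0 < e"
  obtains d where "0 < d"
    "\<And>x y. x \<in> {0..b} \<Longrightarrow> y \<in> {0..b} \<Longrightarrow> \<bar>x - y\<bar> \<le> d \<Longrightarrow> \<bar>x powr q - y powr q\<bar> < e"
proof -
  have "uniformly_continuous_on {0..b} (\<lambda>x. x powr q)"
    using assms by (intro compact_uniformly_continuous continuous_on_powr' continuous_intros) auto
  then obtain d where "0 < d"
    and d: "\<And>x y. x \<in> {0..b} \<Longrightarrow> y \<in> {0..b} \<Longrightarrow> dist x y < d \<Longrightarrow> dist (x powr q) (y powr q) < e"
    using assms(2) unfolding uniformly_continuous_on_def by metis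
  then show thesis
    \<comment> \<open>Halving turns the strict bound on the distance into a non-strict one.\<close>
    by (intro that[of "d / 2"]) (auto simp: dist_real_def)
qed

theorem corollary4p9:
  fixes A :: "('a::t2_space, 4) chart set"
    and g :: "real \<Rightarrow> 'a metric"
    and T R v \<epsilon>\<^sub>0 :: real
  assumes "basic_assumptions A g T"
    and "regularity_constants A g T R v \<epsilon>\<^sub>0"
  shows "(\<forall>t\<in>{T - v<..<T}. good_time A g T t \<longrightarrow> Reg_at A g T R \<epsilon>\<^sub>0 t \<subseteq> Reg A g T \<epsilon>\<^sub>0)
    \<and> (\<forall>p\<in>Reg A g T \<epsilon>\<^sub>0. \<exists>S. T - v < S \<and> S < T \<and>
          (\<forall>t\<in>{S<..<T}. good_time A g T t \<longrightarrow> p \<in> Reg_at A g T R \<epsilon>\<^sub>0 t))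
    \<and> (\<forall>t\<in>{T - v<..<T}. good_time A g T t \<longrightarrow>
          (\<forall>\<epsilon>>0. \<exists>\<delta>>0. \<forall>p\<in>Reg_at A g T R \<epsilon>\<^sub>0 t. \<forall>r\<in>{t<..<T}. \<forall>s\<in>{t<..<T}.
             \<bar>r - s\<bar> \<le> \<delta> \<longrightarrow>
               form_le A p (form_scale (1 - \<epsilon>) (g s p)) (g r p) \<and>
               form_le A p (g r p) (form_scale (1 + \<epsilon>) (g s p))))"
proof (intro conjI ballI allI impI)
  have T: "0 < T" and metric: "\<And>t. t \<in> {0..<T} \<Longrightarrow> riemannian_metric A (g t)"
    using assms(1) by (auto simp: basic_assumptions_def ricci_flow_def)
  have R: "0 < R" and v: "0 < v"
    using assms(2) by (auto simp: regularity_constants_def)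
  {
    fix t assume "t \<in> {T - v<..<T}" "good_time A g T t"
    then show "Reg_at A g T R \<epsilon>\<^sub>0 t \<subseteq> Reg A g T \<epsilon>\<^sub>0"
      using assms(2) unfolding regularity_constants_def by auto
  next
    fix p assume "p \<in> Reg A g T \<epsilon>\<^sub>0"
    then obtain S where "T - v < S" "S < T" "\<And>t. t \<in> {S<..<T} \<Longrightarrow> p \<in> Reg_at A g T R \<epsilon>\<^sub>0 t"
      using Reg_imp_eventually_Reg_at[of p A g T \<epsilon>\<^sub>0 R "T - v"] R v T by auto
    then show "\<exists>S>T - v. S < T \<and> (\<forall>t\<in>{S<..<T}. good_time A g T t \<longrightarrow> p \<in> Reg_at A g T R \<epsilon>\<^sub>0 t)"
      by blast
  next
    fix t \<epsilon> :: real
    assume t: "t \<in> {T - v<..<T}" and good: "good_time A g T t" and \<epsilon>: "0 < \<epsilon>"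
    then have t0: "t \<in> {0..<T}" by (simp add: good_time_def)
    \<comment> \<open>With this c, \<theta> is the difference of the fourth roots divided by c, so
      closeness up to \<open>c * ln (1 + \<epsilon>)\<close> means \<theta> < ln(1 +
      \<epsilon>).\<close>
    define c where "c = (T - t) powr (1 / 4) / 8"
    have c: "0 < c" using t by (simp add: c_def)
    have "0 < c * ln (1 + \<epsilon>)" using c \<epsilon> by simp
    then obtain \<delta> where "0 < \<delta>" and \<delta>: "\<And>x y. x \<in> {0..T - t} \<Longrightarrow> y \<in> {0..T - t} \<Longrightarrow>
        \<bar>x - y\<bar> \<le> \<delta> \<Longrightarrow> \<bar>x powr (1 / 4) - y powr (1 / 4)\<bar> < c * ln (1 + \<epsilon>)"
      using powr_uniformly_close[of "1 / 4" "c * ln (1 + \<epsilon>)" "T - t"] by auto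
    have "form_le A p (form_scale (1 - \<epsilon>) (g s p)) (g r p) \<and>
          form_le A p (g r p) (form_scale (1 + \<epsilon>) (g s p))"
      if p: "p \<in> Reg_at A g T R \<epsilon>\<^sub>0 t" and r: "r \<in> {t<..<T}" and s: "s \<in> {t<..<T}"
        and rs: "\<bar>r - s\<bar> \<le> \<delta>" for p r s
    proof -
      \<comment> \<open>The assumed comparison is used with r and s exchanged, so that g(s) is the
        reference metric.\<close>
      define \<theta> where "\<theta> = 8 * \<bar>(s - t) powr (1 / 4) - (r - t) powr (1 / 4)\<bar> / (T - t) powr (1 / 4)"
      have ball: "p \<in> riem_ball A (g t) p (R / 2 * sqrt (T - t))"
        using t R by (intro centre_in_riem_ball metric t0) auto
      have times: "\<bar>T - t\<bar> \<le> v" "r \<in> {t..<T}" "s \<in> {t..<T}"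
        using t r s by auto
      note compare = assms(2)[unfolded regularity_constants_def, THEN conjunct2, THEN conjunct2,
          THEN conjunct2, THEN spec, THEN spec, THEN mp, OF good, THEN mp, OF times(1), THEN mp, OF p,
          THEN conjunct2, THEN conjunct2, THEN bspec, OF ball, THEN bspec, OF times(3),
          THEN bspec, OF times(2), unfolded Let_def, folded \<theta>_def]
      have lower: "form_le A p (form_scale (exp (- \<theta>)) (g s p)) (g r p)"
        and upper: "form_le A p (g r p) (form_scale (exp \<theta>) (g s p))"
        using compare by simp_all
      have "\<bar>(s - t) powr (1 / 4) - (r - t) powr (1 / 4)\<bar> < c * ln (1 + \<epsilon>)"
        using r s rs by (intro \<delta>) auto
      moreover have "\<theta> = \<bar>(s - t) powr (1 / 4) - (r - t) powr (1 / 4)\<bar> / c"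
        by (simp add: \<theta>_def c_def)
      ultimately have "\<theta> < ln (1 + \<epsilon>)"
        using c by (simp add: pos_divide_less_eq mult.commute)
      then have hi: "exp \<theta> \<le> 1 + \<epsilon>"
        using \<epsilon> exp_le_cancel_iff[of \<theta> "ln (1 + \<epsilon>)"] by simp
      \<comment> \<open>Chain: exp(-\<theta>) \<ge> 1 - \<theta> and \<theta> < ln(1 + \<epsilon>)
        \<le> \<epsilon>.\<close>
      have lo: "1 - \<epsilon> \<le> exp (- \<theta>)"
        using \<open>\<theta> < ln (1 + \<epsilon>)\<close> ln_add_one_self_le_self[of \<epsilon>] exp_ge_add_one_self[of "- \<theta>"] \<epsilon> by linarith
      \<comment> \<open>The scalar bounds on exp(-\<theta>) and exp(\<theta>) pass to quadratic
        forms only after multiplication by a nonnegative number.\<close>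
      have nonneg: "0 \<le> g s p X X" if "X \<in> tangent_space A p" for X
        using riemannian_metric_nonneg[OF metric[of s] that] s t0 by simp
      have "(1 - \<epsilon>) * g s p X X \<le> g r p X X \<and> g r p X X \<le> (1 + \<epsilon>) * g s p X X"
        if X: "X \<in> tangent_space A p" for X
        using order_trans[OF mult_right_mono[OF lo nonneg[OF X]] lower[unfolded form_le_def, THEN bspec, OF X]]
          order_trans[OF upper[unfolded form_le_def, THEN bspec, OF X] mult_right_mono[OF hi nonneg[OF X]]]
        by (rule conjI)
      then show ?thesis
        by (simp add: form_le_def)
    qed
    with \<open>0 < \<delta>\<close> show "\<exists>\<delta>>0. \<forall>p\<in>Reg_at A g T R \<epsilon>\<^sub>0 t. \<forall>r\<in>{t<..<T}. \<forall>s\<in>{t<..<T}.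
             \<bar>r - s\<bar> \<le> \<delta> \<longrightarrow>
               form_le A p (form_scale (1 - \<epsilon>) (g s p)) (g r p) \<and>
               form_le A p (g r p) (form_scale (1 + \<epsilon>) (g s p))"
      by (intro exI[of _ \<delta>] conjI ballI impI) auto
  }
qed

end
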